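(* Let $(P,\cdot,\{~,~\})$ be a Poisson algebra over a field of characteristic $0$, $(V,\mu,\rho)$ a representation of it and $(h,H)$ a Poisson $2$-cocycle of $P$ with coefficients in $(V,\mu,\rho)$. Then a linear map $r:V\to P$ is a $(h,H)$-twisted Rota-Baxter operator if and only if the graph $Gr(r)=\{(r(u),u)\mid u\in V\}$ is a Poisson subalgebra of the twisted semidirect product $(P\oplus V,\cdot_{\ltimes_h},\{~,~\}_{\ltimes_H})$.
   Context: A Poisson algebra is a vector space with a commutative associative product and a Lie bracket such that the bracket satisfies the Leibniz rule $\{x,yz\}=\{x,y\}z+y\{x,z\}$; a Poisson subalgebra is a subspace closed under both operations. A representation $(V,\mu,\rho)$ of $(P,\cdot,\{~,~\})$ is a vector space $V$ with linear maps $\mu,\rho:P\to\mathrm{End}(V)$ such that $\mu_{x\cdot y}=\mu_x\mu_y$, $\rho_{\{x,y\}}=\rho_x\rho_y-\rho_y\rho_x$, $\mu_{\{x,y\}}=\rho_x\mu_y-\mu_y\rho_x$, $\rho_{x\cdot y}=\mu_x\rho_y+\mu_y\rho_x$. A Poisson $2$-cocycle is a pair $(h,H)$ with $h:P\times P\to V$ symmetric bilinear and $H:P\times P\to V$ skew-symmetric bilinear, satisfying for all $x,y,z\in P$: $\mu_xh(y,z)-h(x\cdot y,z)+h(x,y\cdot z)-\mu_zh(x,y)=0$; $\rho_xH(y,z)+\rho_yH(z,x)+\rho_zH(x,y)+H(x,\{y,z\})+H(y,\{z,x\})+H(z,\{x,y\})=0$; $\rho_xh(y,z)-h(\{x,y\},z)-h(y,\{x,z\})+H(x,y\cdot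 z)-\mu_yH(x,z)-\mu_zH(x,y)=0$. The twisted semidirect product is the Poisson algebra $P\oplus V$ with $(x,u)\cdot_{\ltimes_h}(y,v)=(x\cdot y,\ \mu_xv+\mu_yu+h(x,y))$ and $\{(x,u),(y,v)\}_{\ltimes_H}=(\{x,y\},\ \rho_xv-\rho_yu+H(x,y))$. A linear map $r:V\to P$ is a $(h,H)$-twisted Rota-Baxter operator if for all $u,v\in V$: $r(u)\cdot r(v)=r\big(\mu_{r(u)}v+\mu_{r(v)}u+h(r(u),r(v))\big)$ and $\{r(u),r(v)\}=r\big(\rho_{r(u)}v-\rho_{r(v)}u+H(r(u),r(v))\big)$. *)

theory Defs
  imports "HOL-Analysis.Product_Vector"
begin

definition bilinear_map ::
  "('k::field \<Rightarrow> 'a::ab_group_add \<Rightarrow> 'a) \<Rightarrow> ('k \<Rightarrow> 'b::ab_group_add \<Rightarrow> 'b) \<Rightarrow>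
   ('k \<Rightarrow> 'c::ab_group_add \<Rightarrow> 'c) \<Rightarrow> ('a \<Rightarrow> 'b \<Rightarrow> 'c) \<Rightarrow> bool" where
  "bilinear_map sA sB sC f \<longleftrightarrow>
     (\<forall>x. Vector_Spaces.linear sB sC (\<lambda>y. f x y)) \<and>
     (\<forall>y. Vector_Spaces.linear sA sC (\<lambda>x. f x y))"

locale poisson_algebra = vector_space sP
  for sP :: "'k::field \<Rightarrow> 'p::ab_group_add \<Rightarrow> 'p" +
  fixes mul :: "'p \<Rightarrow> 'p \<Rightarrow> 'p"
    and brk :: "'p \<Rightarrow> 'p \<Rightarrow> 'p"
  assumes mul_bilinear: "bilinear_map sP sP sP mul"
    and mul_commute: "mul x y = mul y x"
    and mul_assoc: "mul (mul x y) z = mul x (mul y z)"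
    and brk_bilinear: "bilinear_map sP sP sP brk"
    and brk_alternating: "brk x x = 0"
    and jacobi: "brk x (brk y z) + brk y (brk z x) + brk z (brk x y) = 0"
    and leibniz: "brk x (mul y z) = mul (brk x y) z + mul y (brk x z)"

locale poisson_subalgebra = poisson_algebra sP mul brk
  for sP :: "'k::field \<Rightarrow> 'p::ab_group_add \<Rightarrow> 'p"
    and mul brk :: "'p \<Rightarrow> 'p \<Rightarrow> 'p" +
  fixes S :: "'p set"
  assumes is_subspace: "subspace S"
    and mul_closed: "x \<in> S \<Longrightarrow> y \<in> S \<Longrightarrow> mul x y \<in> S"
    and brk_closed: "x \<in> S \<Longrightarrow> y \<in> S \<Longrightarrow> brk x y \<in> S"

text \<open>
  A linear map from \<open>P\<close> to \<open>End(V)\<close> is given in curried form, as a bilinear map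
  \<open>P \<times> V \<rightarrow> V\<close>.
\<close>

locale poisson_representation = poisson_algebra sP mul brk + V: vector_space sV
  for sP :: "'k::field \<Rightarrow> 'p::ab_group_add \<Rightarrow> 'p"
    and mul brk :: "'p \<Rightarrow> 'p \<Rightarrow> 'p"
    and sV :: "'k \<Rightarrow> 'v::ab_group_add \<Rightarrow> 'v" +
  fixes \<mu> \<rho> :: "'p \<Rightarrow> 'v \<Rightarrow> 'v"
  assumes mu_bilinear: "bilinear_map sP sV sV \<mu>"
    and rho_bilinear: "bilinear_map sP sV sV \<rho>"
    and mu_mul: "\<mu> (mul x y) v = \<mu> x (\<mu> y v)"
    and rho_brk: "\<rho> (brk x y) v = \<rho> x (\<rho> y v) - \<rho> y (\<rho> x v)"
    and mu_brk: "\<mu> (brk x y) v = \<rho> x (\<mu> y v) - \<mu> y (\<rho> x v)"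
    and rho_mul: "\<rho> (mul x y) v = \<mu> x (\<rho> y v) + \<mu> y (\<rho> x v)"

locale poisson_2_cocycle = poisson_representation sP mul brk sV \<mu> \<rho>
  for sP :: "'k::field \<Rightarrow> 'p::ab_group_add \<Rightarrow> 'p"
    and mul brk :: "'p \<Rightarrow> 'p \<Rightarrow> 'p"
    and sV :: "'k \<Rightarrow> 'v::ab_group_add \<Rightarrow> 'v"
    and \<mu> \<rho> :: "'p \<Rightarrow> 'v \<Rightarrow> 'v" +
  fixes h H :: "'p \<Rightarrow> 'p \<Rightarrow> 'v"
  assumes h_bilinear: "bilinear_map sP sP sV h"
    and h_symmetric: "h x y = h y x"
    and H_bilinear: "bilinear_map sP sP sV H"
    and H_skew: "H x y = - H y x"
    and h_cocycle: "\<mu> x (h y z) - h (mul x y) z + h x (mul y z) - \<mu> z (h x y) = 0"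
    and H_cocycle: "\<rho> x (H y z) + \<rho> y (H z x) + \<rho> z (H x y)
        + H x (brk y z) + H y (brk z x) + H z (brk x y) = 0"
    and hH_cocycle: "\<rho> x (h y z) - h (brk x y) z - h y (brk x z)
        + H x (mul y z) - \<mu> y (H x z) - \<mu> z (H x y) = 0"

definition twisted_mul ::
  "('p \<Rightarrow> 'p \<Rightarrow> 'p) \<Rightarrow> ('p \<Rightarrow> 'v::ab_group_add \<Rightarrow> 'v) \<Rightarrow> ('p \<Rightarrow> 'p \<Rightarrow> 'v) \<Rightarrow>
   'p \<times> 'v \<Rightarrow> 'p \<times> 'v \<Rightarrow> 'p \<times> 'v" where
  "twisted_mul mul \<mu> h = (\<lambda>(x, u) (y, v). (mul x y, \<mu> x v + \<mu> y u + h x y))"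

definition twisted_brk ::
  "('p \<Rightarrow> 'p \<Rightarrow> 'p) \<Rightarrow> ('p \<Rightarrow> 'v::ab_group_add \<Rightarrow> 'v) \<Rightarrow> ('p \<Rightarrow> 'p \<Rightarrow> 'v) \<Rightarrow>
   'p \<times> 'v \<Rightarrow> 'p \<times> 'v \<Rightarrow> 'p \<times> 'v" where
  "twisted_brk brk \<rho> H = (\<lambda>(x, u) (y, v). (brk x y, \<rho> x v - \<rho> y u + H x y))"

context poisson_2_cocycle
begin

definition twisted_rota_baxter_operator :: "('v \<Rightarrow> 'p) \<Rightarrow> bool" where
  "twisted_rota_baxter_operator r \<longleftrightarrow>
     Vector_Spaces.linear sV sP r \<and>
     (\<forall>u v. mul (r u) (r v) = r (\<mu> (r u) v + \<mu> (r v) u + h (r u) (r v))) \<and>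
     (\<forall>u v. brk (r u) (r v) = r (\<rho> (r u) v - \<rho> (r v) u + H (r u) (r v)))"

end

definition op_graph :: "('v \<Rightarrow> 'p) \<Rightarrow> ('p \<times> 'v) set" where
  "op_graph r = {(r u, u) | u. True}"

lemma bilinear_map_simps:
  assumes "bilinear_map sA sB sC f"
  shows "f (a + a') b = f a b + f a' b" "f a (b + b') = f a b + f a b'"
    "f (a - a') b = f a b - f a' b" "f a (b - b') = f a b - f a b'"
    "f (sA c a) b = sC c (f a b)" "f a (sB c b) = sC c (f a b)"
proof -
  interpret l: Vector_Spaces.linear sB sC "\<lambda>b. f a b" for a
    using assms by (simp add: bilinear_map_def)
  interpret r: Vector_Spaces.linear sA sC "\<lambda>a. f a b" for b
    using assms by (simp add: bilinear_map_def)
  show "f (a + a') b = f a b + f a' b" "f a (b + b') = f a b + f a b'"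
    "f (a - a') b = f a b - f a' b" "f a (b - b') = f a b - f a b'"
    "f (sA c a) b = sC c (f a b)" "f a (sB c b) = sC c (f a b)"
    by (rule r.add l.add r.diff l.diff r.scale l.scale)+
qed

lemma bilinear_mapI:
  assumes "vector_space sA" "vector_space sB" "vector_space sC"
    and "\<And>a a' b. f (a + a') b = f a b + f a' b"
    and "\<And>a b b'. f a (b + b') = f a b + f a b'"
    and "\<And>c a b. f (sA c a) b = sC c (f a b)"
    and "\<And>c a b. f a (sB c b) = sC c (f a b)"
  shows "bilinear_map sA sB sC f"
  using assms
  by (simp add: bilinear_map_def Vector_Spaces.linear_def module_hom_axioms_def
      module_hom_def module_iff_vector_space)

text \<open>
  The twisted semidirect product is a Poisson algebra.  Characteristic \<open>0\<close> is needed to get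
  \<open>H x x = 0\<close> from skew-symmetry.
\<close>

theorem twisted_semidirect_product:
  fixes sP :: "'k::field_char_0 \<Rightarrow> 'p::ab_group_add \<Rightarrow> 'p"
    and sV :: "'k \<Rightarrow> 'v::ab_group_add \<Rightarrow> 'v"
  assumes "poisson_2_cocycle sP mul brk sV \<mu> \<rho> h H"
  shows "poisson_algebra (module_prod.scale sP sV) (twisted_mul mul \<mu> h) (twisted_brk brk \<rho> H)"
proof -
  interpret poisson_2_cocycle sP mul brk sV \<mu> \<rho> h H by fact
  interpret pr: vector_space_prod sP sV ..
  note bil = bilinear_map_simps[OF mul_bilinear] bilinear_map_simps[OF brk_bilinear]
    bilinear_map_simps[OF mu_bilinear] bilinear_map_simps[OF rho_bilinear]
    bilinear_map_simps[OF h_bilinear] bilinear_map_simps[OF H_bilinear]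
  note sc = scale_right_distrib V.scale_right_distrib V.scale_right_diff_distrib
  have mu_commute: "\<mu> x (\<mu> y v) = \<mu> y (\<mu> x v)" for x y v
    by (metis mu_mul mul_commute)
  have H_alt: "H x x = 0" for x
  proof -
    have "H x x + H x x = 0" using H_skew[of x x] by (metis add.right_inverse)
    then have "sV 2 (H x x) = 0" using V.scale_left_distrib[of 1 1 "H x x"] by simp
    then show ?thesis by simp
  qed
  show ?thesis
  proof (unfold_locales, goal_cases)
    case 1 show ?case
      by (rule bilinear_mapI; (unfold_locales)?)
        (auto simp: twisted_mul_def pr.scale_def bil sc algebra_simps)
  next
    case (2 x y) show ?case
      by (auto simp: twisted_mul_def mul_commute h_symmetric split: prod.splits)
  next
    case (3 X Y Z)
    obtain x u y v z w where [simp]: "X = (x, u)" "Y = (y, v)" "Z = (z, w)"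
      by (metis surj_pair)
    have "\<mu> x (h y z) + h x (mul y z) = h (mul x y) z + \<mu> z (h x y)"
      using h_cocycle[of x y z] by (simp add: algebra_simps)
    then show ?case
      by (simp add: twisted_mul_def mul_assoc bil mu_mul algebra_simps mu_commute)
  next
    case 4 show ?case
      by (rule bilinear_mapI; (unfold_locales)?)
        (auto simp: twisted_brk_def pr.scale_def bil sc algebra_simps)
  next
    case (5 X) show ?case
      by (auto simp: twisted_brk_def brk_alternating H_alt zero_prod_def split: prod.splits)
  next
    case (6 X Y Z)
    obtain x u y v z w where [simp]: "X = (x, u)" "Y = (y, v)" "Z = (z, w)"
      by (metis surj_pair)
    show ?case
      using H_cocycle[of x y z] jacobi[of x y z]
      by (simp add: twisted_brk_def zero_prod_def bil rho_brk algebra_simps)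
  next
    case (7 X Y Z)
    obtain x u y v z w where [simp]: "X = (x, u)" "Y = (y, v)" "Z = (z, w)"
      by (metis surj_pair)
    have "\<rho> x (h y z) + H x (mul y z) = h (brk x y) z + h y (brk x z) + \<mu> y (H x z) + \<mu> z (H x y)"
      using hH_cocycle[of x y z] by (simp add: algebra_simps)
    then show ?case
      by (simp add: twisted_brk_def twisted_mul_def leibniz bil mu_brk rho_mul algebra_simps)
  qed
qed

end

theory Submission
  imports Defs
begin

text \<open>A pair lies in the graph exactly when its first component is the image under
  \<open>r\<close> of its second. The twisted product of \<open>(r u, u)\<close> and
  \<open>(r v, v)\<close> has first component \<open>mul (r u) (r v)\<close> and as second component
  the argument of \<open>r\<close> in the Rota-Baxter identity, so closure under the product is that
  identity; the bracket behaves likewise. Linearity of \<open>r\<close> makes the graph a subspace,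
  and \<open>twisted_semidirect_product\<close> supplies the ambient Poisson algebra.\<close>

lemma mem_op_graph [simp]: "(x, u) \<in> op_graph r \<longleftrightarrow> x = r u"
  by (auto simp: op_graph_def)

lemma twisted_mul_closed_op_graph_iff:
  "(\<forall>X\<in>op_graph r. \<forall>Y\<in>op_graph r. twisted_mul mul \<mu> h X Y \<in> op_graph r) \<longleftrightarrow>
    (\<forall>u v. mul (r u) (r v) = r (\<mu> (r u) v + \<mu> (r v) u + h (r u) (r v)))"
  \<comment> \<open>Unfolding \<open>Ball_def\<close> exposes the membership premises;
    \<open>mem_op_graph\<close> then fixes the first components, leaving quantifiers over
    \<open>u\<close> and \<open>v\<close> alone.\<close>
  by (simp add: Ball_def twisted_mul_def)

lemma twisted_brk_closed_op_graph_iff: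
  "(\<forall>X\<in>op_graph r. \<forall>Y\<in>op_graph r. twisted_brk brk \<rho> H X Y \<in> op_graph r) \<longleftrightarrow>
    (\<forall>u v. brk (r u) (r v) = r (\<rho> (r u) v - \<rho> (r v) u + H (r u) (r v)))"
  by (simp add: Ball_def twisted_brk_def)

text \<open>Zero, sums and scalar multiples of pairs are componentwise, and \<open>r\<close>
  commutes with each of them.\<close>

lemma subspace_op_graph:
  assumes "Vector_Spaces.linear sV sP r"
  shows "module.subspace (module_prod.scale sP sV) (op_graph r)"
proof -
  interpret r: Vector_Spaces.linear sV sP r by fact
  interpret pr: vector_space_prod sP sV ..
  show ?thesis
    by (auto simp: pr.p.subspace_def pr.scale_def zero_prod_def r.zero r.add r.scale)
qed

theorem proposition5p19:
  fixes sP :: "'k::field_char_0 \<Rightarrow> 'p::ab_group_add \<Rightarrow> 'p"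
    and sV :: "'k \<Rightarrow> 'v::ab_group_add \<Rightarrow> 'v"
    and mul brk :: "'p \<Rightarrow> 'p \<Rightarrow> 'p"
    and \<mu> \<rho> :: "'p \<Rightarrow> 'v \<Rightarrow> 'v"
    and h H :: "'p \<Rightarrow> 'p \<Rightarrow> 'v"
    and r :: "'v \<Rightarrow> 'p"
  assumes "poisson_algebra sP mul brk"
    and "poisson_representation sP mul brk sV \<mu> \<rho>"
    and "poisson_2_cocycle sP mul brk sV \<mu> \<rho> h H"
    and "Vector_Spaces.linear sV sP r"
  shows "poisson_2_cocycle.twisted_rota_baxter_operator sP mul brk sV \<mu> \<rho> h H r \<longleftrightarrow>
    poisson_subalgebra (module_prod.scale sP sV) (twisted_mul mul \<mu> h) (twisted_brk brk \<rho> H)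
      (op_graph r)"
proof -
  interpret poisson_2_cocycle sP mul brk sV \<mu> \<rho> h H by fact
  \<comment> \<open>The locale \<open>poisson_subalgebra\<close> also asserts that the ambient
    structure is a Poisson algebra; the cocycle identities and characteristic 0 enter here.\<close>
  interpret P: poisson_algebra "module_prod.scale sP sV" "twisted_mul mul \<mu> h" "twisted_brk brk \<rho> H"
    using assms(3) by (rule twisted_semidirect_product)
  show ?thesis
    \<comment> \<open>Read from right to left, the two equivalences turn the operator identities
      into closure conditions on the graph, the same ones that the subalgebra axioms state.\<close>
    unfolding twisted_rota_baxter_operator_def poisson_subalgebra_def poisson_subalgebra_axioms_def
      twisted_mul_closed_op_graph_iff [symmetric] twisted_brk_closed_op_graph_iff [symmetric]
    using P.poisson_algebra_axioms subspace_op_graph [OF assms(4)] assms(4) by blast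
qed

end
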